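(* Let $h:\mathbb R^n\to\mathbb R$ be convex and $\beta$-smooth with respect to the Euclidean norm $\|\cdot\|$, let $x_0\in\mathbb R^n$, and suppose $\Delta:=h(x_0)-\inf_{x\in\mathbb R^n}h(x)<\infty$. For any $\gamma\in(0,\sqrt{2\beta\Delta})$, there is a choice of iteration count $K=O\!\left(1+\log(\sqrt{\beta\Delta}/\gamma)\right)$ such that the output $z_K$ of the critical-point algorithm (defined in the context) with $$\lambda_k=\frac{2^k}{32}\ \text{ for }k\in\{0,\dots,K-1\}\qquad\text{and}\qquad\epsilon_k=\frac{\Delta}{64\cdot1.5^k}\ \text{ for }k\in\{1,\dots,K\}$$ satisfies $\|\nabla h(z_K)\|\le\gamma$, and the algorithm makes at most $O\!\left(\frac{\sqrt{\beta\Delta}}{\gamma}\right)$ gradient queries to $h$.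
   Context: $h$ is accessed through a gradient oracle; a gradient query returns $\nabla h(x)$ at a chosen $x$. Let $f(x):=h(x)+\frac{\gamma^2}{16\Delta}\|x-x_0\|^2$ (one query to $\nabla f$ costs one query to $\nabla h$), $R:=5\Delta/\gamma$, and $B_\zeta(w):=\{x\in\mathbb R^n:\|x-w\|\le\zeta\}$. CGM oracle: for $\zeta>0$, $w\in\mathbb R^n$, $\epsilon>0$, $\mathrm{CGM}(\zeta,w,\epsilon)$ returns an $\epsilon$-minimizer of $f$ over $B_\zeta(w)$ (a point $z\in B_\zeta(w)$ with $f(z)\le\min_{B_\zeta(w)}f+\epsilon$), using at most $O\!\left(1+\sqrt{\beta\zeta^2/\epsilon}\right)$ queries to $\nabla f$. (Such an oracle is known to be implementable by fast composite gradient methods.) Critical-point algorithm. Set $z_0:=x_0$. For $k=1,\dots,K$: set $\Lambda_k=\sum_{j=0}^{k-1}\lambda_j$, $w_k=\frac{z_0+\sum_{j=0}^{k-1}\lambda_jz_j}{1+\Lambda_k}$, and $z_k=\mathrm{CGM}\!\left(\frac{R}{1+\Lambda_k},w_k,\frac{\epsilon_k}{1+\Lambda_k}\right)$. Return $z_K$. The constants hidden in $O(\cdot)$ in the claim are universal (given the universal constant in the CGM oracle). *)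

theory Defs
  imports "HOL-Analysis.Analysis"
begin

section \<open>Euclidean spaces of all finite dimensions inside one type\<close>

text \<open>
  The constants hidden in the complexity bounds must not depend on the dimension, so the
  dimension has to be quantified inside the formula, below these constants, and cannot be a type.
  We use the inner product space of finitely supported real sequences; \<open>Rn n\<close> is
  \<open>\<real>\<^sup>n\<close>, realised as the sequences supported in \<open>{0..<n}\<close>.
\<close>

typedef fseq = "{x :: nat \<Rightarrow> real. finite {i. x i \<noteq> 0}}"
  morphisms coord Abs_fseq
  by (rule exI[of _ "\<lambda>_. 0"]) simp

setup_lifting type_definition_fseq

lemma finite_coord [simp]: "finite {i. coord x i \<noteq> 0}"
  using coord[of x] by simp

lemma fseq_eqI: "(\<And>i. coord x i = coord y i) \<Longrightarrow> x = y"
  by (simp add: coord_inject[symmetric] ext)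

instantiation fseq :: real_vector
begin

lift_definition zero_fseq :: fseq is "\<lambda>_. 0" by simp

lift_definition plus_fseq :: "fseq \<Rightarrow> fseq \<Rightarrow> fseq" is "\<lambda>x y i. x i + y i"
  by (rule finite_subset[rotated], erule finite_UnI, assumption) auto

lift_definition minus_fseq :: "fseq \<Rightarrow> fseq \<Rightarrow> fseq" is "\<lambda>x y i. x i - y i"
  by (rule finite_subset[rotated], erule finite_UnI, assumption) auto

lift_definition uminus_fseq :: "fseq \<Rightarrow> fseq" is "\<lambda>x i. - x i"
  by simp

lift_definition scaleR_fseq :: "real \<Rightarrow> fseq \<Rightarrow> fseq" is "\<lambda>r x i. r * x i"
  by (rule finite_subset[rotated], assumption) auto

instance
  by standard (transfer; simp add: fun_eq_iff algebra_simps)+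

end

lemmas coord_simps [simp] =
  zero_fseq.rep_eq plus_fseq.rep_eq minus_fseq.rep_eq uminus_fseq.rep_eq scaleR_fseq.rep_eq

instantiation fseq :: real_inner
begin

definition inner_fseq :: "fseq \<Rightarrow> fseq \<Rightarrow> real"
  where "inner_fseq x y = (\<Sum>i | coord x i \<noteq> 0. coord x i * coord y i)"

definition norm_fseq :: "fseq \<Rightarrow> real"
  where "norm_fseq x = sqrt (x \<bullet> x)"

definition sgn_fseq :: "fseq \<Rightarrow> fseq"
  where "sgn_fseq x = x /\<^sub>R norm x"

definition dist_fseq :: "fseq \<Rightarrow> fseq \<Rightarrow> real"
  where "dist_fseq x y = norm (x - y)"

definition uniformity_fseq :: "(fseq \<times> fseq) filter"
  where "uniformity_fseq = (INF e\<in>{0<..}. principal {(x, y). dist x y < e})"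

definition open_fseq :: "fseq set \<Rightarrow> bool"
  where "open_fseq U \<longleftrightarrow> (\<forall>x\<in>U. \<forall>\<^sub>F (x', y) in uniformity. x' = x \<longrightarrow> y \<in> U)"

lemma inner_fseq_eq_sum:
  assumes "finite A" "{i. coord x i \<noteq> 0} \<subseteq> A"
  shows "x \<bullet> y = (\<Sum>i\<in>A. coord x i * coord y i)"
  unfolding inner_fseq_def using assms by (intro sum.mono_neutral_left) auto

instance
proof
  fix x y z :: fseq and r :: real
  define A where "A = {i. coord x i \<noteq> 0} \<union> {i. coord y i \<noteq> 0} \<union> {i. coord z i \<noteq> 0}"
  have fin: "finite A"
    by (simp add: A_def)
  have eq: "u \<bullet> v = (\<Sum>i\<in>A. coord u i * coord v i)" if "{i. coord u i \<noteq> 0} \<subseteq> A" for u v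
    using inner_fseq_eq_sum[OF fin that] .
  have sub: "{i. coord x i \<noteq> 0} \<subseteq> A" "{i. coord y i \<noteq> 0} \<subseteq> A"
    "{i. coord (x + y) i \<noteq> 0} \<subseteq> A" "{i. coord (r *\<^sub>R x) i \<noteq> 0} \<subseteq> A"
    by (auto simp: A_def)
  show "x \<bullet> y = y \<bullet> x"
    by (simp add: eq sub mult.commute)
  show "(x + y) \<bullet> z = x \<bullet> z + y \<bullet> z"
    by (simp only: eq sub) (simp add: ring_distribs sum.distrib)
  show "(r *\<^sub>R x) \<bullet> y = r * (x \<bullet> y)"
    by (simp only: eq sub) (simp add: sum_distrib_left mult.assoc)
  show "0 \<le> x \<bullet> x"
    by (simp add: inner_fseq_def sum_nonneg)
  show "x \<bullet> x = 0 \<longleftrightarrow> x = 0"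
  proof
    assume "x \<bullet> x = 0"
    then have "\<forall>i\<in>{i. coord x i \<noteq> 0}. coord x i * coord x i = 0"
      unfolding inner_fseq_def by (subst (asm) sum_nonneg_eq_0_iff) auto
    then show "x = 0"
      by (intro fseq_eqI) auto
  qed (simp add: inner_fseq_def)
qed (simp_all add: norm_fseq_def sgn_fseq_def dist_fseq_def uniformity_fseq_def open_fseq_def)

end

definition Rn :: "nat \<Rightarrow> fseq set"
  where "Rn n = {x. \<forall>i\<ge>n. coord x i = 0}"

lemma subspace_Rn: "subspace (Rn n)"
  by (auto simp: subspace_def Rn_def)

lemma inner_Rn: "x \<in> Rn n \<Longrightarrow> x \<bullet> y = (\<Sum>i<n. coord x i * coord y i)"
  by (intro inner_fseq_eq_sum) (auto simp: Rn_def not_le intro: leI)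

lemma norm_Rn: "x \<in> Rn n \<Longrightarrow> norm x = sqrt (\<Sum>i<n. (coord x i)\<^sup>2)"
  by (simp add: norm_eq_sqrt_inner inner_Rn power2_eq_square)

lemma bij_betw_coord_Rn: "bij_betw coord (Rn n) {x. \<forall>i\<ge>n. x i = 0}"
proof (rule bij_betw_imageI)
  show "inj_on coord (Rn n)"
    by (simp add: inj_on_def coord_inject)
  have "x \<in> coord ` Rn n" if "\<forall>i\<ge>n. x i = 0" for x
  proof -
    have "{i. x i \<noteq> 0} \<subseteq> {..<n}"
      using that by (auto simp: not_le intro: leI)
    then have "coord (Abs_fseq x) = x"
      by (intro Abs_fseq_inverse) (auto intro: finite_subset)
    then show ?thesis
      using that by (intro image_eqI[of _ _ "Abs_fseq x"]) (auto simp: Rn_def)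
  qed
  then show "coord ` Rn n = {x. \<forall>i\<ge>n. x i = 0}"
    by (auto simp: Rn_def)
qed


section \<open>Gradients and smoothness on a subspace\<close>

text \<open>
  Functions on \<open>\<real>\<^sup>n\<close> are functions on the ambient type of which only the values on
  \<open>S = Rn n\<close> matter. Requiring the gradient to lie in \<open>S\<close> makes it unique.
\<close>

definition has_grad :: "'a::real_inner set \<Rightarrow> ('a \<Rightarrow> real) \<Rightarrow> 'a \<Rightarrow> 'a \<Rightarrow> bool"
  where "has_grad S h x g \<longleftrightarrow> g \<in> S \<and> (h has_derivative (\<lambda>v. g \<bullet> v)) (at x within S)"

definition grad :: "'a::real_inner set \<Rightarrow> ('a \<Rightarrow> real) \<Rightarrow> 'a \<Rightarrow> 'a"
  where "grad S h x = (THE g. has_grad S h x g)"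

definition smooth :: "'a::real_inner set \<Rightarrow> real \<Rightarrow> ('a \<Rightarrow> real) \<Rightarrow> bool"
  where "smooth S \<beta> h \<longleftrightarrow>
    (\<forall>x\<in>S. \<exists>g. has_grad S h x g) \<and> \<beta>-lipschitz_on S (grad S h)"

lemma has_grad_unique:
  assumes S: "subspace S" and x: "x \<in> S" and g: "has_grad S h x g" and g': "has_grad S h x g'"
  shows "g = g'"
proof -
  define d where "d = g - g'"
  have d: "d \<in> S"
    using g g' S by (simp add: d_def has_grad_def subspace_diff)
  have line: "((\<lambda>t. x + t *\<^sub>R d) has_derivative (\<lambda>t. t *\<^sub>R d)) (at 0)"
    by (auto intro!: derivative_eq_intros)
  have img: "(\<lambda>t. x + t *\<^sub>R d) ` UNIV \<subseteq> S"
    using S x d by (auto intro: subspace_add subspace_scale)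
  have deriv: "((\<lambda>t. h (x + t *\<^sub>R d)) has_derivative (\<lambda>t. k \<bullet> (t *\<^sub>R d))) (at 0)"
    if "has_grad S h x k" for k
  proof -
    have "(h has_derivative (\<lambda>v. k \<bullet> v)) (at (x + 0 *\<^sub>R d) within (\<lambda>t. x + t *\<^sub>R d) ` UNIV)"
      using that img by (auto simp: has_grad_def intro: has_derivative_subset)
    from diff_chain_within[OF line this] show ?thesis
      by (simp add: o_def)
  qed
  have "(\<lambda>t. g \<bullet> (t *\<^sub>R d)) = (\<lambda>t. g' \<bullet> (t *\<^sub>R d))"
    by (rule has_derivative_unique[OF deriv[OF g] deriv[OF g']])
  then have "g \<bullet> (1 *\<^sub>R d) = g' \<bullet> (1 *\<^sub>R d)"
    by meson
  then have "d \<bullet> d = 0"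
    by (simp add: d_def inner_diff_left)
  then show ?thesis
    by (simp add: d_def)
qed

lemma grad_eq: "subspace S \<Longrightarrow> x \<in> S \<Longrightarrow> has_grad S h x g \<Longrightarrow> grad S h x = g"
  unfolding grad_def by (blast intro: has_grad_unique)


section \<open>Algorithms with access to an oracle\<close>

text \<open>
  A deterministic algorithm adaptively queries points of \<open>'a\<close>, receives answers in
  \<open>'a\<close>, and finally returns a value in \<open>'r\<close>.
\<close>

datatype ('a, 'r) alg = Return 'r | Query 'a "'a \<Rightarrow> ('a, 'r) alg"

primrec result :: "('a \<Rightarrow> 'a) \<Rightarrow> ('a, 'r) alg \<Rightarrow> 'r" where
  "result orc (Return r) = r"
| "result orc (Query x c) = result orc (c (orc x))"

primrec queries :: "('a \<Rightarrow> 'a) \<Rightarrow> ('a, 'r) alg \<Rightarrow> 'a list" where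
  "queries orc (Return r) = []"
| "queries orc (Query x c) = x # queries orc (c (orc x))"

primrec bind :: "('a, 'r) alg \<Rightarrow> ('r \<Rightarrow> ('a, 's) alg) \<Rightarrow> ('a, 's) alg" where
  "bind (Return r) q = q r"
| "bind (Query x c) q = Query x (\<lambda>a. bind (c a) q)"

text \<open>
  \<open>translate \<phi> p\<close> runs \<open>p\<close>, answering its query at \<open>x\<close> by
  \<open>\<phi> x a\<close>, where \<open>a\<close> is the actual oracle's answer at \<open>x\<close>.
\<close>

primrec translate :: "('a \<Rightarrow> 'a \<Rightarrow> 'a) \<Rightarrow> ('a, 'r) alg \<Rightarrow> ('a, 'r) alg" where
  "translate \<phi> (Return r) = Return r"
| "translate \<phi> (Query x c) = Query x (\<lambda>a. translate \<phi> (c (\<phi> x a)))"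


section \<open>The critical-point algorithm\<close>

definition regularized :: "real \<Rightarrow> real \<Rightarrow> 'a::real_inner \<Rightarrow> ('a \<Rightarrow> real) \<Rightarrow> 'a \<Rightarrow> real"
  where "regularized \<gamma> \<Delta> x0 h x = h x + \<gamma>\<^sup>2 / (16 * \<Delta>) * (norm (x - x0))\<^sup>2"

definition regularized_answer :: "real \<Rightarrow> real \<Rightarrow> 'a::real_inner \<Rightarrow> 'a \<Rightarrow> 'a \<Rightarrow> 'a"
  where "regularized_answer \<gamma> \<Delta> x0 x g = g + (\<gamma>\<^sup>2 / (8 * \<Delta>)) *\<^sub>R (x - x0)"

lemma grad_regularized:
  assumes S: "subspace S" and x: "x \<in> S" "x0 \<in> S" and h: "has_grad S h x g"
  shows "grad S (regularized \<gamma> \<Delta> x0 h) x = regularized_answer \<gamma> \<Delta> x0 x (grad S h x)"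
proof -
  have "has_grad S (regularized \<gamma> \<Delta> x0 h) x (regularized_answer \<gamma> \<Delta> x0 x g)"
    unfolding has_grad_def
  proof
    show "regularized_answer \<gamma> \<Delta> x0 x g \<in> S"
      using assms
      by (auto simp: regularized_answer_def has_grad_def
          intro!: subspace_add subspace_scale subspace_diff)
    have "(h has_derivative (\<lambda>v. g \<bullet> v)) (at x within S)"
      using h by (simp add: has_grad_def)
    then have "((\<lambda>y. h y + c * ((y - x0) \<bullet> (y - x0))) has_derivative
        (\<lambda>v. (g + (2 * c) *\<^sub>R (x - x0)) \<bullet> v)) (at x within S)" for c
      by (auto intro!: derivative_eq_intros simp: inner_add_left inner_commute algebra_simps)
    from this[of "\<gamma>\<^sup>2 / (16 * \<Delta>)"]
    show "(regularized \<gamma> \<Delta> x0 h has_derivative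
        (\<lambda>v. regularized_answer \<gamma> \<Delta> x0 x g \<bullet> v)) (at x within S)"
      unfolding regularized_def[abs_def] regularized_answer_def power2_norm_eq_inner
      by simp
  qed
  then show ?thesis
    using grad_eq[OF S x(1)] h by simp
qed

text \<open>
  \<open>cgm \<zeta> w \<epsilon>\<close> is an algorithm querying the gradient of \<open>f\<close>; it may only
  query points of \<open>S\<close>, the domain of \<open>f\<close>.
\<close>

definition cgm_oracle ::
  "real \<Rightarrow> real \<Rightarrow> 'a::real_inner set \<Rightarrow> ('a \<Rightarrow> real)
    \<Rightarrow> (real \<Rightarrow> 'a \<Rightarrow> real \<Rightarrow> ('a, 'a) alg) \<Rightarrow> bool"
  where "cgm_oracle C \<beta> S f cgm \<longleftrightarrow>
    (\<forall>\<zeta>>0. \<forall>w\<in>S. \<forall>\<epsilon>>0.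
      let z = result (grad S f) (cgm \<zeta> w \<epsilon>);
          qs = queries (grad S f) (cgm \<zeta> w \<epsilon>)
      in z \<in> S \<inter> cball w \<zeta> \<and>
         (\<forall>y \<in> S \<inter> cball w \<zeta>. f z \<le> f y + \<epsilon>) \<and>
         set qs \<subseteq> S \<and>
         real (length qs) \<le> C * (1 + sqrt (\<beta> * \<zeta>\<^sup>2 / \<epsilon>)))"

text \<open>
  The list of iterates \<open>[z\<^sub>0, \<dots>, z\<^sub>k]\<close>, computed with queries to the gradient of
  \<open>h\<close>.
\<close>

primrec cp_iterates ::
  "(real \<Rightarrow> 'a::real_inner \<Rightarrow> real \<Rightarrow> ('a, 'a) alg) \<Rightarrow> real \<Rightarrow> real \<Rightarrow> 'a
    \<Rightarrow> (nat \<Rightarrow> real) \<Rightarrow> (nat \<Rightarrow> real) \<Rightarrow> nat \<Rightarrow> ('a, 'a list) alg" where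
  "cp_iterates cgm \<gamma> \<Delta> x0 lam eps 0 = Return [x0]"
| "cp_iterates cgm \<gamma> \<Delta> x0 lam eps (Suc m) =
    bind (cp_iterates cgm \<gamma> \<Delta> x0 lam eps m) (\<lambda>zs.
      let k = Suc m;
          R = 5 * \<Delta> / \<gamma>;
          \<Lambda> = (\<Sum>j<k. lam j);
          w = (zs ! 0 + (\<Sum>j<k. lam j *\<^sub>R zs ! j)) /\<^sub>R (1 + \<Lambda>)
      in bind (translate (regularized_answer \<gamma> \<Delta> x0)
                (cgm (R / (1 + \<Lambda>)) w (eps k / (1 + \<Lambda>))))
           (\<lambda>z. Return (zs @ [z])))"

definition critical_point_alg ::
  "(real \<Rightarrow> 'a::real_inner \<Rightarrow> real \<Rightarrow> ('a, 'a) alg) \<Rightarrow> real \<Rightarrow> real \<Rightarrow> 'a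
    \<Rightarrow> (nat \<Rightarrow> real) \<Rightarrow> (nat \<Rightarrow> real) \<Rightarrow> nat \<Rightarrow> ('a, 'a) alg"
  where "critical_point_alg cgm \<gamma> \<Delta> x0 lam eps K =
    bind (cp_iterates cgm \<gamma> \<Delta> x0 lam eps K) (\<lambda>zs. Return (zs ! K))"

end

theory Submission
  imports Defs
begin

text \<open>
  Write \<open>f\<close> for the regularized function, \<open>c = \<gamma>\<^sup>2 / (16 \<Delta>)\<close> for its quadratic
  coefficient, \<open>W\<^sub>k = 1 + \<Lambda>\<^sub>k\<close>, and \<open>B\<^sub>k\<close> for the ball of radius \<open>R / W\<^sub>k\<close> around
  \<open>w\<^sub>k\<close> over which \<open>z\<^sub>k\<close> approximately minimizes \<open>f\<close>. No distance to the
  global minimizer of \<open>f\<close> is tracked, since the balls may fail to contain it. What forces the gradient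
  \<open>g = \<nabla>f(z\<^sub>K)\<close> to be small is the shape of the last ball: an exact minimizer of \<open>f\<close> over
  \<open>B\<^sub>K\<close> satisfies \<open>(R / W\<^sub>K) \<parallel>g\<parallel> \<le> g \<bullet> (w\<^sub>K - z\<^sub>K)\<close>, because otherwise a step towards
  the boundary point of \<open>B\<^sub>K\<close> in the direction \<open>-g\<close> would decrease \<open>f\<close>; an approximate
  minimizer satisfies this up to an error (\<open>approx_min_on_ball_gradient\<close>).

  Now \<open>W\<^sub>K w\<^sub>K\<close> is the weighted sum of \<open>z\<^sub>0\<close> and the earlier iterates, so summing the
  convexity inequalities \<open>g \<bullet> (z\<^sub>j - z\<^sub>K) \<le> f(z\<^sub>j) - f(z\<^sub>K)\<close> with the same weights
  (\<open>weighted_center_averaging\<close>) gives, up to that error,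
  \<open>R \<parallel>g\<parallel> + c \<parallel>z\<^sub>K - x\<^sub>0\<parallel>\<^sup>2 \<le> (f(x\<^sub>0) - f(z\<^sub>K)) + \<Sum>\<^sub>j \<lambda>\<^sub>j (f(z\<^sub>j) - f(z\<^sub>K))\<close>,
  where the quadratic term is the strong convexity of \<open>f\<close> used for \<open>j = 0\<close> only.
  The first summand is at most \<open>\<Delta> - c \<parallel>z\<^sub>K - x\<^sub>0\<parallel>\<^sup>2\<close>. For the second, the radii and centers
  fit together such that the balls are nested (\<open>weighted_center_balls_nested\<close>). Hence
  \<open>z\<^sub>K \<in> B\<^sub>j\<close>, so \<open>f(z\<^sub>j) - f(z\<^sub>K) \<le> \<epsilon>\<^sub>j / W\<^sub>j\<close> for \<open>0 < j < K\<close>, and since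
  \<open>\<lambda>\<^sub>j \<le> W\<^sub>j\<close> these terms add up to at most \<open>\<Sum>\<^sub>j \<epsilon>\<^sub>j\<close>, a small multiple of \<open>\<Delta>\<close>. The term
  for \<open>j = 0\<close> repeats the first summand with weight \<open>1 / 32\<close>.

  The result is \<open>R \<parallel>g\<parallel> + 2 c \<parallel>z\<^sub>K - x\<^sub>0\<parallel>\<^sup>2 \<le> 2 \<Delta>\<close> (\<open>grad_f_bound\<close>). As
  \<open>\<nabla>h(z\<^sub>K) = g - 2 c (z\<^sub>K - x\<^sub>0)\<close>, this bounds \<open>\<parallel>\<nabla>h(z\<^sub>K)\<parallel>\<close> by a concave quadratic in
  \<open>\<parallel>z\<^sub>K - x\<^sub>0\<parallel>\<close> whose maximum is below \<open>\<gamma>\<close>.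

  The error from approximate minimality is small once \<open>3\<^sup>K\<close> dominates \<open>\<rho>\<^sup>2\<close>, where
  \<open>\<rho> = \<surd>(\<beta> \<Delta>) / \<gamma>\<close>, so \<open>K\<close> can be chosen logarithmic in \<open>\<rho>\<close>. The number of queries in
  round \<open>k\<close> is of order \<open>1 + \<rho> \<surd>(1.5\<^sup>k / 2\<^sup>k)\<close>; the sum over \<open>k\<close> is of order
  \<open>K + \<rho>\<close>, and \<open>K\<close> is absorbed because \<open>ln \<rho> \<le> \<rho> - 1\<close>.
\<close>


section \<open>Running composed algorithms\<close>

lemma result_bind [simp]: "result orc (bind p q) = result orc (q (result orc p))"
  by (induction p) auto

lemma queries_bind [simp]:
  "queries orc (bind p q) = queries orc p @ queries orc (q (result orc p))"
  by (induction p) auto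

text \<open>
  Outside the domain of a function the translated answers need not be its gradients, so the agreement of
  the two oracles is confined to a set \<open>S\<close> that the queries do not leave.
\<close>

lemma run_translate:
  assumes "set (queries orc' p) \<subseteq> S" and "\<And>x. x \<in> S \<Longrightarrow> orc' x = \<phi> x (orc x)"
  shows "result orc (translate \<phi> p) = result orc' p"
    and "queries orc (translate \<phi> p) = queries orc' p"
proof -
  have "result orc (translate \<phi> p) = result orc' p \<and> queries orc (translate \<phi> p) = queries orc' p"
    using assms(1) by (induction p) (auto simp: assms(2)[symmetric])
  then show "result orc (translate \<phi> p) = result orc' p"
    and "queries orc (translate \<phi> p) = queries orc' p" by auto
qed


section \<open>First-order inequalities on a subspace\<close>

text \<open>
  A whole line through two points of \<open>S\<close> stays in \<open>S\<close>, which reduces the claim to a convex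
  function of one real variable that is differentiable in the ordinary sense.
\<close>

lemma has_grad_above_tangent:
  assumes S: "subspace S" and conv: "convex_on S h" and x: "x \<in> S" and y: "y \<in> S"
    and g: "has_grad S h x g"
  shows "h x + g \<bullet> (y - x) \<le> h y"
proof -
  define l where "l = (\<lambda>t. x + t *\<^sub>R (y - x))"
  have lS: "l t \<in> S" for t
    using S x y by (auto simp: l_def intro!: subspace_add subspace_scale subspace_diff)
  have conv': "convex_on UNIV (\<lambda>t. h (l t))"
  proof (rule convex_onI)
    fix t a b :: real assume t: "0 < t" "t < 1"
    have "l ((1 - t) *\<^sub>R a + t *\<^sub>R b) = (1 - t) *\<^sub>R l a + t *\<^sub>R l b"
      by (simp add: l_def algebra_simps)
    then show "h (l ((1 - t) *\<^sub>R a + t *\<^sub>R b)) \<le> (1 - t) * h (l a) + t * h (l b)"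
      using convex_onD[OF conv, of t "l a" "l b"] t lS by simp
  qed simp
  have line: "(l has_derivative (\<lambda>t. t *\<^sub>R (y - x))) (at 0)"
    unfolding l_def by (auto intro!: derivative_eq_intros)
  have "(h has_derivative (\<lambda>v. g \<bullet> v)) (at (l 0) within range l)"
    using g lS by (auto simp: has_grad_def l_def intro: has_derivative_subset)
  from diff_chain_within[OF line this]
  have "((\<lambda>t. h (l t)) has_real_derivative g \<bullet> (y - x)) (at 0)"
    by (simp add: o_def has_field_derivative_def mult_commute_abs)
  from convex_on_imp_above_tangent[OF conv', of 0 1, OF _ _ _ this]
  show ?thesis
    by (simp add: l_def)
qed

lemma smooth_has_grad:
  assumes "subspace S" "smooth S \<beta> h" "x \<in> S"
  shows "has_grad S h x (grad S h x)"
  using assms grad_eq unfolding smooth_def by metis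

lemma grad_in_subspace:
  assumes "subspace S" "smooth S \<beta> h" "x \<in> S"
  shows "grad S h x \<in> S"
  using smooth_has_grad[OF assms] by (simp add: has_grad_def)

lemma convex_smooth_above_tangent:
  assumes "subspace S" "convex_on S h" "smooth S \<beta> h" "x \<in> S" "y \<in> S"
  shows "h x + grad S h x \<bullet> (y - x) \<le> h y"
  using assms by (blast intro: has_grad_above_tangent smooth_has_grad)

text \<open>
  The sharp constant is \<open>\<beta> / 2\<close>. Applying the tangent inequality at \<open>y\<close> and
  moving the gradient from \<open>y\<close> to \<open>x\<close> loses a factor \<open>2\<close>, which only affects
  hidden constants, and needs no integration along the segment.
\<close>

lemma convex_smooth_quadratic_upper_bound:
  assumes "subspace S" "convex_on S h" "smooth S \<beta> h" "x \<in> S" "y \<in> S"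
  shows "h y \<le> h x + grad S h x \<bullet> (y - x) + \<beta> * (norm (y - x))\<^sup>2"
proof -
  have "(grad S h y - grad S h x) \<bullet> (y - x) \<le> norm (grad S h y - grad S h x) * norm (y - x)"
    by (rule norm_cauchy_schwarz)
  also have "\<dots> \<le> \<beta> * norm (y - x) * norm (y - x)"
    using assms by (intro mult_right_mono) (auto simp: smooth_def lipschitz_on_def dist_norm)
  finally have "grad S h y \<bullet> (y - x) \<le> grad S h x \<bullet> (y - x) + \<beta> * (norm (y - x))\<^sup>2"
    by (simp add: inner_diff_left power2_eq_square)
  moreover have "h y + grad S h y \<bullet> (x - y) \<le> h x"
    using assms by (intro convex_smooth_above_tangent)
  ultimately show ?thesis
    by (simp add: inner_diff_right)
qed

text \<open>
  The square expands exactly, so upper and lower bounds on the Taylor remainder of \<open>h\<close>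
  carry over to the regularized function with only the quadratic term added.
\<close>

lemma regularized_expansion:
  "regularized \<gamma> \<Delta> x0 h y =
    regularized \<gamma> \<Delta> x0 h x + (regularized_answer \<gamma> \<Delta> x0 x g \<bullet> (y - x))
    + (h y - h x - g \<bullet> (y - x)) + \<gamma>\<^sup>2 / (16 * \<Delta>) * (norm (y - x))\<^sup>2"
proof -
  have "(norm (y - x0))\<^sup>2 = (norm (x - x0))\<^sup>2 + 2 * ((x - x0) \<bullet> (y - x)) + (norm (y - x))\<^sup>2"
    by (simp add: power2_norm_eq_inner inner_diff_left inner_diff_right inner_commute)
  moreover have "\<gamma>\<^sup>2 / (8 * \<Delta>) = 2 * (\<gamma>\<^sup>2 / (16 * \<Delta>))"
    by simp
  ultimately show ?thesis
    by (simp only: regularized_def regularized_answer_def inner_add_left inner_scaleR_left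
        distrib_left)
qed


section \<open>Approximate minimizers over balls\<close>

text \<open>
  Moving from \<open>z\<close> by the fraction \<open>t\<close> of the way to the point \<open>a\<close> of the ball that
  minimizes the linear function \<open>g\<close> stays in the ball, so it can lower \<open>f\<close> by at most
  \<open>\<delta>\<close>. Small \<open>t\<close> weakens the influence of the curvature \<open>L\<close> but amplifies \<open>\<delta>\<close>.
\<close>

lemma approx_min_on_ball_gradient:
  fixes f :: "'a::real_inner \<Rightarrow> real"
  assumes S: "subspace S" and mem: "w \<in> S" "z \<in> S" "g \<in> S" and z: "z \<in> cball w r"
    and t: "0 < t" "t \<le> 1" and L: "0 \<le> L"
    and upper: "\<And>u. u \<in> S \<Longrightarrow> f u \<le> f z + g \<bullet> (u - z) + L * (norm (u - z))\<^sup>2"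
    and minz: "\<And>u. u \<in> S \<inter> cball w r \<Longrightarrow> f z \<le> f u + \<delta>"
  shows "r * norm g \<le> g \<bullet> (w - z) + \<delta> / t + 4 * L * t * r\<^sup>2"
proof -
  have r: "0 \<le> r"
    using z by (meson zero_le_dist mem_cball order_trans)
  define a where "a = w - r *\<^sub>R sgn g"
  define u where "u = z + t *\<^sub>R (a - z)"
  have aw: "a \<in> cball w r"
    using r by (simp add: a_def dist_norm norm_sgn)
  have aS: "a \<in> S"
    using S mem by (auto simp: a_def sgn_div_norm intro!: subspace_diff subspace_scale)
  have uS: "u \<in> S"
    using S mem aS by (auto simp: u_def intro!: subspace_add subspace_diff subspace_scale)
  have "u = (1 - t) *\<^sub>R z + t *\<^sub>R a"
    by (simp add: u_def algebra_simps)
  then have uw: "u \<in> cball w r"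
    using convexD[OF convex_cball z aw, of "1 - t" t] t by simp
  have "norm (a - z) \<le> 2 * r"
    using aw z by (metis add_mono dist_commute dist_norm dist_triangle2 mem_cball mult_2 order_trans)
  then have "(norm (a - z))\<^sup>2 \<le> (2 * r)\<^sup>2"
    by (intro power_mono) auto
  then have "L * t * (norm (a - z))\<^sup>2 \<le> L * t * (4 * r\<^sup>2)"
    using L t by (intro mult_left_mono) (auto simp: power_mult_distrib)
  moreover have "0 \<le> \<delta> + t * (g \<bullet> (a - z)) + L * (t\<^sup>2 * (norm (a - z))\<^sup>2)"
    using minz[of u] upper[OF uS] uS uw by (simp add: u_def power_mult_distrib)
  then have "0 \<le> (\<delta> + t * (g \<bullet> (a - z)) + L * (t\<^sup>2 * (norm (a - z))\<^sup>2)) / t"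
    using t by simp
  then have "0 \<le> \<delta> / t + g \<bullet> (a - z) + L * t * (norm (a - z))\<^sup>2"
    using t by (simp add: add_divide_distrib power2_eq_square)
  moreover have "g \<bullet> (a - z) = g \<bullet> (w - z) - r * norm g"
  proof -
    have "g \<bullet> sgn g = norm g"
      by (simp add: sgn_div_norm dot_square_norm power2_eq_square field_simps)
    then show ?thesis
      by (simp add: a_def inner_diff_right)
  qed
  ultimately show ?thesis
    by simp
qed

definition weighted_center :: "(nat \<Rightarrow> real) \<Rightarrow> (nat \<Rightarrow> 'a::real_vector) \<Rightarrow> nat \<Rightarrow> 'a"
  where "weighted_center lam z k =
    (z 0 + (\<Sum>j<k. lam j *\<^sub>R z j)) /\<^sub>R (1 + (\<Sum>j<k. lam j))"

lemma weighted_center_diff: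
  assumes "\<And>j. 0 \<le> lam j"
  shows "(1 + (\<Sum>j<k. lam j)) *\<^sub>R (weighted_center lam z k - x)
    = (z 0 - x) + (\<Sum>j<k. lam j *\<^sub>R (z j - x))"
proof -
  have "0 \<le> (\<Sum>j<k. lam j)"
    using assms by (simp add: sum_nonneg)
  then show ?thesis
    by (simp add: weighted_center_def scaleR_diff_right sum_subtractf scaleR_sum_left
        scaleR_add_left)
qed

text \<open>
  The new center lies on the segment from \<open>w\<close> to \<open>z k\<close>, and since \<open>z k\<close> is within the old
  radius, the center moves by at most the amount by which the radius shrinks.
\<close>

lemma weighted_center_balls_nested:
  fixes z :: "nat \<Rightarrow> 'a::real_normed_vector"
  assumes lam: "\<And>j. 0 \<le> lam j"
    and z: "z k \<in> cball (weighted_center lam z k) (R / (1 + (\<Sum>j<k. lam j)))"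
  shows "cball (weighted_center lam z (Suc k)) (R / (1 + (\<Sum>j<Suc k. lam j)))
    \<subseteq> cball (weighted_center lam z k) (R / (1 + (\<Sum>j<k. lam j)))"
proof -
  define a where "a = 1 + (\<Sum>j<k. lam j)"
  define b where "b = 1 + (\<Sum>j<Suc k. lam j)"
  define w where "w = weighted_center lam z k"
  define w' where "w' = weighted_center lam z (Suc k)"
  have a: "0 < a"
    using lam by (simp add: a_def sum_nonneg add_pos_nonneg)
  have ab: "b = a + lam k"
    by (simp add: a_def b_def)
  have b: "0 < b"
    using a lam[of k] ab by simp
  have "b *\<^sub>R (w' - w) = a *\<^sub>R (w - w) + lam k *\<^sub>R (z k - w)"
    unfolding a_def b_def w'_def using weighted_center_diff[where lam = lam and k = k and z = z and x = w]
      weighted_center_diff[where lam = lam and k = "Suc k" and z = z and x = w] lam by (simp add: w_def)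
  then have "(1 / b) *\<^sub>R b *\<^sub>R (w' - w) = (1 / b) *\<^sub>R lam k *\<^sub>R (z k - w)"
    by simp
  then have "w' - w = (lam k / b) *\<^sub>R (z k - w)"
    using b by simp
  then have "dist w w' = lam k / b * dist w (z k)"
    using b lam[of k] by (simp add: dist_norm norm_minus_commute)
  also have "\<dots> \<le> lam k / b * (R / a)"
    using z b lam[of k] by (intro mult_left_mono) (auto simp: a_def w_def)
  also have "\<dots> = R / a - R / b"
    using a b by (simp add: ab field_simps)
  finally have "dist w w' \<le> R / a - R / b" .
  then show ?thesis
    unfolding a_def[symmetric] b_def[symmetric] w_def[symmetric] w'_def[symmetric]
    by (auto intro!: order_trans[OF dist_triangle[of w _ w']])
qed

text \<open>
  The slack \<open>q\<close> is for a strong convexity term at the starting point, whose distance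
  to the output has to be controlled.
\<close>

lemma weighted_center_averaging:
  fixes f :: "'a::real_inner \<Rightarrow> real"
  assumes lam: "\<And>j. 0 \<le> lam j"
    and lower: "\<And>j. j < k \<Longrightarrow> f x + g \<bullet> (z j - x) \<le> f (z j)"
    and lower0: "f x + g \<bullet> (z 0 - x) + q \<le> f (z 0)"
  shows "(1 + (\<Sum>j<k. lam j)) * (g \<bullet> (weighted_center lam z k - x)) + q
    \<le> (f (z 0) - f x) + (\<Sum>j<k. lam j * (f (z j) - f x))"
proof -
  have "(1 + (\<Sum>j<k. lam j)) * (g \<bullet> (weighted_center lam z k - x))
      = g \<bullet> (z 0 - x) + (\<Sum>j<k. lam j * (g \<bullet> (z j - x)))"
    using arg_cong[OF weighted_center_diff[where lam = lam and k = k and z = z and x = x, OF lam], of "\<lambda>v. g \<bullet> v"]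
    by (simp add: inner_add_right inner_sum_right)
  moreover have "(\<Sum>j<k. lam j * (g \<bullet> (z j - x))) \<le> (\<Sum>j<k. lam j * (f (z j) - f x))"
    using lam lower by (intro sum_mono mult_left_mono) (force simp: algebra_simps)+
  ultimately show ?thesis
    using lower0 by simp
qed


section \<open>The critical-point algorithm\<close>

locale critical_point_run =
  fixes S :: "'a::real_inner set" and h :: "'a \<Rightarrow> real" and \<beta> \<Delta> \<gamma> C :: real and x0 :: 'a
    and cgm :: "real \<Rightarrow> 'a \<Rightarrow> real \<Rightarrow> ('a, 'a) alg"
  assumes S: "subspace S" and conv: "convex_on S h" and smooth: "smooth S \<beta> h"
    and x0: "x0 \<in> S" and gap: "\<And>x. x \<in> S \<Longrightarrow> h x0 - h x \<le> \<Delta>"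
    and \<Delta>: "0 < \<Delta>" and \<gamma>: "0 < \<gamma>" and \<gamma>_less: "\<gamma>\<^sup>2 < 2 * \<beta> * \<Delta>"
    and C: "0 < C"
    and cgm: "cgm_oracle C \<beta> S (regularized \<gamma> \<Delta> x0 h) cgm"
begin

definition lam :: "nat \<Rightarrow> real" where "lam k = 2 ^ k / 32"
definition eps :: "nat \<Rightarrow> real" where "eps k = \<Delta> / (64 * 1.5 ^ k)"
definition weight :: "nat \<Rightarrow> real" where "weight k = 1 + (\<Sum>j<k. lam j)"
definition R :: real where "R = 5 * \<Delta> / \<gamma>"
definition \<rho> :: real where "\<rho> = sqrt (\<beta> * \<Delta>) / \<gamma>"

abbreviation f :: "'a \<Rightarrow> real" where "f \<equiv> regularized \<gamma> \<Delta> x0 h"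

abbreviation iterates :: "nat \<Rightarrow> ('a, 'a list) alg"
  where "iterates \<equiv> cp_iterates cgm \<gamma> \<Delta> x0 lam eps"

definition z :: "nat \<Rightarrow> 'a" where "z k = result (grad S h) (iterates k) ! k"

abbreviation w :: "nat \<Rightarrow> 'a" where "w \<equiv> weighted_center lam z"

abbreviation inner_run :: "nat \<Rightarrow> ('a, 'a) alg"
  where "inner_run k \<equiv> cgm (R / weight k) (w k) (eps k / weight k)"

lemma \<beta>_pos: "0 < \<beta>"
proof -
  have "0 < 2 * \<beta> * \<Delta>"
    using \<gamma>_less by (rule order_le_less_trans[rotated]) simp
  then show ?thesis
    using \<Delta> by (simp add: zero_less_mult_iff)
qed

lemma lam_nonneg: "0 \<le> lam k"
  by (simp add: lam_def)

lemma eps_pos: "0 < eps k"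
  using \<Delta> by (simp add: eps_def)

lemma R_pos: "0 < R"
  using \<Delta> \<gamma> by (simp add: R_def)

lemma weight_eq: "weight k = (31 + 2 ^ k) / 32"
  unfolding weight_def by (induction k) (auto simp: lam_def)

lemma lam_le_weight: "lam k \<le> weight k"
  by (simp add: weight_eq lam_def)

lemma weight_pos: "0 < weight k"
  by (simp add: weight_eq add_pos_pos)

lemma \<rho>_pos: "0 < \<rho>"
  using \<beta>_pos \<Delta> \<gamma> by (simp add: \<rho>_def)

lemma \<rho>_sq: "\<rho>\<^sup>2 = \<beta> * \<Delta> / \<gamma>\<^sup>2"
  using \<beta>_pos \<Delta> by (simp add: \<rho>_def power_divide)

lemma grad_f:
  "x \<in> S \<Longrightarrow> grad S f x = regularized_answer \<gamma> \<Delta> x0 x (grad S h x)"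
  using grad_regularized[OF S _ x0 smooth_has_grad[OF S smooth]] by blast

lemma inner_run:
  assumes "w k \<in> S"
  shows "result (grad S f) (inner_run k) \<in> S \<inter> cball (w k) (R / weight k)"
    and "y \<in> S \<inter> cball (w k) (R / weight k) \<Longrightarrow>
      f (result (grad S f) (inner_run k)) \<le> f y + eps k / weight k"
    and "result (grad S h) (translate (regularized_answer \<gamma> \<Delta> x0) (inner_run k))
      = result (grad S f) (inner_run k)"
    and "real (length (queries (grad S h) (translate (regularized_answer \<gamma> \<Delta> x0) (inner_run k))))
      \<le> C * (1 + sqrt (\<beta> * (R / weight k)\<^sup>2 / (eps k / weight k)))"
proof -
  have run: "result (grad S f) (inner_run k) \<in> S \<inter> cball (w k) (R / weight k)
     \<and> (\<forall>y \<in> S \<inter> cball (w k) (R / weight k).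
          f (result (grad S f) (inner_run k)) \<le> f y + eps k / weight k)
     \<and> set (queries (grad S f) (inner_run k)) \<subseteq> S
     \<and> real (length (queries (grad S f) (inner_run k)))
        \<le> C * (1 + sqrt (\<beta> * (R / weight k)\<^sup>2 / (eps k / weight k)))"
    using cgm assms R_pos weight_pos[of k] eps_pos[of k]
    unfolding cgm_oracle_def Let_def by (simp del: divide_divide_eq_right)
  note tr = run_translate[of "grad S f" "inner_run k" S "regularized_answer \<gamma> \<Delta> x0" "grad S h",
      OF _ grad_f]
  show "result (grad S f) (inner_run k) \<in> S \<inter> cball (w k) (R / weight k)"
    and "y \<in> S \<inter> cball (w k) (R / weight k) \<Longrightarrow>
      f (result (grad S f) (inner_run k)) \<le> f y + eps k / weight k"
    using run by auto
  show "result (grad S h) (translate (regularized_answer \<gamma> \<Delta> x0) (inner_run k))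
      = result (grad S f) (inner_run k)"
    and "real (length (queries (grad S h) (translate (regularized_answer \<gamma> \<Delta> x0) (inner_run k))))
      \<le> C * (1 + sqrt (\<beta> * (R / weight k)\<^sup>2 / (eps k / weight k)))"
    using run tr by auto
qed

text \<open>
  Each round only appends to the list of iterates, so \<open>z\<close>, which reads off the last entry of
  every run, describes all entries.
\<close>

lemma iterates_nth:
  "length (result (grad S h) (iterates k)) = Suc k \<and>
   (\<forall>j\<le>k. result (grad S h) (iterates k) ! j = z j)"
proof (induction k)
  case (Suc k)
  obtain x where x: "result (grad S h) (iterates (Suc k)) = result (grad S h) (iterates k) @ [x]"
    by (simp add: Let_def)
  then have "result (grad S h) (iterates (Suc k)) ! j = z j" if "j \<le> Suc k" for j
  proof (cases "j = Suc k")
    case True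
    then show ?thesis
      by (simp only: z_def)
  next
    case False
    then show ?thesis
      using that Suc x by (simp add: nth_append del: cp_iterates.simps)
  qed
  with Suc x show ?case
    by (simp del: cp_iterates.simps)
qed (simp add: z_def)

lemma iterates_Suc:
  "iterates (Suc k) = bind (iterates k) (\<lambda>zs.
     bind (translate (regularized_answer \<gamma> \<Delta> x0)
       (cgm (R / weight (Suc k)) (weighted_center lam (nth zs) (Suc k))
         (eps (Suc k) / weight (Suc k)))) (\<lambda>x. Return (zs @ [x])))"
  by (simp only: cp_iterates.simps Let_def R_def weight_def weighted_center_def)

lemma center_of_iterates:
  "weighted_center lam (nth (result (grad S h) (iterates k))) (Suc k) = w (Suc k)"
  unfolding weighted_center_def using iterates_nth[of k] by (simp add: less_Suc_eq_le)

lemma z_0: "z 0 = x0"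
  by (simp add: z_def)

lemma z_Suc:
  "z (Suc k) = result (grad S h) (translate (regularized_answer \<gamma> \<Delta> x0) (inner_run (Suc k)))"
  using iterates_nth[of k]
  by (simp add: z_def[of "Suc k"] iterates_Suc center_of_iterates nth_append
      del: cp_iterates.simps)

lemma center_mem:
  assumes "\<And>j. j < k \<Longrightarrow> z j \<in> S"
  shows "w k \<in> S"
  unfolding weighted_center_def using S x0 assms
  by (intro subspace_scale subspace_add subspace_sum) (auto simp: z_0)

lemma z_mem: "z k \<in> S"
proof (induction k rule: less_induct)
  case (less k)
  show ?case
  proof (cases k)
    case (Suc m)
    then have "w (Suc m) \<in> S"
      using less by (intro center_mem) auto
    then show ?thesis
      using inner_run(1,3)[of "Suc m"] by (simp add: Suc z_Suc)
  qed (use x0 z_0 in simp)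
qed

lemma w_mem: "w k \<in> S"
  by (intro center_mem z_mem)

lemma z_in_ball: "z k \<in> cball (w k) (R / weight k)"
proof (cases k)
  case 0
  then show ?thesis
    using R_pos by (simp add: weighted_center_def weight_def)
next
  case (Suc m)
  then show ?thesis
    using inner_run(1,3)[OF w_mem, of k] by (simp add: z_Suc)
qed

lemma z_approx_min:
  assumes "0 < k" "y \<in> S \<inter> cball (w k) (R / weight k)"
  shows "f (z k) \<le> f y + eps k / weight k"
  using assms inner_run(2,3)[OF w_mem, where k = k] by (cases k) (auto simp: z_Suc)

lemma z_later_in_ball:
  assumes "j \<le> k"
  shows "z k \<in> cball (w j) (R / weight j)"
proof -
  have "cball (w k) (R / weight k) \<subseteq> cball (w j) (R / weight j)"
    using assms
  proof (induction rule: dec_induct)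
    case (step m)
    have "cball (w (Suc m)) (R / weight (Suc m)) \<subseteq> cball (w m) (R / weight m)"
      using z_in_ball[of m] unfolding weight_def
      by (intro weighted_center_balls_nested lam_nonneg)
    with step show ?case by blast
  qed simp
  then show ?thesis
    using z_in_ball by blast
qed

text \<open>
  The point \<open>z K\<close> competes in every earlier minimization because the balls are nested. The
  starting point minimizes nothing, so its term is kept; its weight \<open>1 / 32\<close> is small.
\<close>

lemma weighted_errors:
  assumes "0 < K"
  shows "(\<Sum>j<K. lam j * (f (z j) - f (z K))) \<le> (f x0 - f (z K)) / 32 + \<Delta> / 16"
proof -
  have bound: "lam j * (f (z j) - f (z K)) \<le> \<Delta> / 64 * (2 / 3) ^ j" if "0 < j" "j < K" for j
  proof -
    have "f (z j) \<le> f (z K) + eps j / weight j"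
      using that z_mem z_later_in_ball[of j K] by (intro z_approx_min) auto
    then have "lam j * (f (z j) - f (z K)) \<le> lam j * (eps j / weight j)"
      by (intro mult_left_mono lam_nonneg) simp
    also have "\<dots> = (lam j / weight j) * eps j"
      by simp
    also have "\<dots> \<le> 1 * eps j"
      using lam_le_weight[of j] weight_pos[of j] eps_pos[of j] by (intro mult_right_mono) auto
    also have "1 * eps j = \<Delta> / 64 * (2 / 3) ^ j"
      by (simp add: eps_def power_divide)
    finally show ?thesis .
  qed
  have "{..<K} = insert 0 {1..<K}"
    using assms by auto
  then have split: "(\<Sum>j<K. lam j * (f (z j) - f (z K)))
      = (f x0 - f (z K)) / 32 + (\<Sum>j=1..<K. lam j * (f (z j) - f (z K)))"
    by (simp add: z_0 lam_def)
  have "(\<Sum>j=1..<K. lam j * (f (z j) - f (z K))) \<le> (\<Sum>j=1..<K. \<Delta> / 64 * (2 / 3) ^ j)"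
    using bound by (intro sum_mono) auto
  also have "\<dots> \<le> (\<Sum>j<K. \<Delta> / 64 * (2 / 3) ^ j)"
    using \<Delta> by (intro sum_mono2) auto
  also have "\<dots> = \<Delta> / 64 * (3 * (1 - (2 / 3) ^ K))"
  proof -
    have "(\<Sum>j<K. (2 / 3 :: real) ^ j) = 3 * (1 - (2 / 3) ^ K)"
      by (simp add: sum_gp_strict)
    then show ?thesis
      by (simp only: sum_distrib_left[symmetric])
  qed
  also have "\<dots> \<le> \<Delta> / 16"
    using \<Delta> by (simp add: field_simps)
  finally show ?thesis
    unfolding split by simp
qed

lemma beta_R_sq: "\<beta> * R\<^sup>2 = 25 * \<rho>\<^sup>2 * \<Delta>"
  unfolding \<rho>_sq R_def using \<gamma> by (simp add: power_divide power_mult_distrib power2_eq_square)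

lemma inverse_weight_le: "1 / weight k \<le> 32 / 2 ^ k"
  by (simp add: weight_eq field_simps add_pos_pos)

text \<open>
  The step length \<open>t = (2 / 3) ^ K\<close> balances the two errors of
  \<open>approx_min_on_ball_gradient\<close>: it turns the accuracy \<open>eps K\<close> into the constant
  \<open>\<Delta> / 64\<close>, while the curvature error, which carries a factor \<open>t / weight K\<close>, becomes of
  order \<open>\<rho>\<^sup>2 * \<Delta> / 3 ^ K\<close>.
\<close>

lemma grad_f_bound:
  assumes K: "0 < K" and large: "4200 * \<rho>\<^sup>2 \<le> 3 ^ K"
  shows "R * norm (grad S f (z K)) + \<gamma>\<^sup>2 / (8 * \<Delta>) * (norm (z K - x0))\<^sup>2 \<le> 2 * \<Delta>"
proof -
  define c where "c = \<gamma>\<^sup>2 / (16 * \<Delta>)"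
  define t :: real where "t = (2 / 3) ^ K"
  define g where "g = grad S f (z K)"
  define e where "e = g \<bullet> (w K - z K)"
  \<comment> \<open>The bound on \<open>\<gamma>\<close> makes the regularization a small part of the smoothness.\<close>
  have c: "0 < c" "c \<le> \<beta> / 8"
    using \<Delta> \<gamma> \<gamma>_less by (auto simp: c_def field_simps)
  have t: "0 < t" "t \<le> 1"
    by (auto simp: t_def power_le_one)
  have g_eq: "g = regularized_answer \<gamma> \<Delta> x0 (z K) (grad S h (z K))"
    by (simp add: g_def grad_f z_mem)
  have gS: "g \<in> S"
    unfolding g_eq regularized_answer_def using S x0 z_mem grad_in_subspace[OF S smooth]
    by (intro subspace_add subspace_scale subspace_diff) auto
  note expansion = regularized_expansion[of \<gamma> \<Delta> x0 h _ "z K" "grad S h (z K)",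
      folded g_eq c_def]
  have lower: "f (z K) + g \<bullet> (y - z K) + c * (norm (y - z K))\<^sup>2 \<le> f y" if "y \<in> S" for y
    using expansion[of y] convex_smooth_above_tangent[OF S conv smooth z_mem that, of K] by simp
  have upper: "f y \<le> f (z K) + g \<bullet> (y - z K) + 9 / 8 * \<beta> * (norm (y - z K))\<^sup>2"
    if "y \<in> S" for y
  proof -
    have "c * (norm (y - z K))\<^sup>2 \<le> \<beta> / 8 * (norm (y - z K))\<^sup>2"
      using c by (intro mult_right_mono) auto
    then show ?thesis
      using expansion[of y] convex_smooth_quadratic_upper_bound[OF S conv smooth z_mem that, of K]
      by simp
  qed
  have "R / weight K * norm g
      \<le> e + (eps K / weight K) / t + 4 * (9 / 8 * \<beta>) * t * (R / weight K)\<^sup>2"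
    unfolding e_def
  proof (rule approx_min_on_ball_gradient[OF S w_mem z_mem gS z_in_ball t _ upper])
    show "f (z K) \<le> f u + eps K / weight K" if "u \<in> S \<inter> cball (w K) (R / weight K)" for u
      using z_approx_min[OF K that] .
  qed (use \<beta>_pos in auto)
  then have "weight K * (R / weight K * norm g) \<le> weight K *
      (e + (eps K / weight K) / t + 4 * (9 / 8 * \<beta>) * t * (R / weight K)\<^sup>2)"
    using weight_pos[of K] by (intro mult_left_mono) auto
  also have "\<dots> = weight K * e + eps K / t + 9 / 2 * (\<beta> * R\<^sup>2) * (t * (1 / weight K))"
    using weight_pos[of K] by (simp add: field_simps power2_eq_square)
  finally have "R * norm g \<le> weight K * e + eps K / t
      + 9 / 2 * (\<beta> * R\<^sup>2) * (t * (1 / weight K))"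
    using weight_pos[of K] by simp
  moreover have "eps K / t = \<Delta> / 64"
    by (simp add: eps_def t_def power_divide)
  moreover have "9 / 2 * (\<beta> * R\<^sup>2) * (t * (1 / weight K)) \<le> 7 / 8 * \<Delta>"
  proof -
    have "t * (1 / weight K) \<le> t * (32 / 2 ^ K)"
      using t inverse_weight_le by (intro mult_left_mono) auto
    also have "\<dots> = 32 / 3 ^ K"
      by (simp add: t_def power_divide)
    finally have "9 / 2 * (\<beta> * R\<^sup>2) * (t * (1 / weight K))
        \<le> 9 / 2 * (25 * \<rho>\<^sup>2 * \<Delta>) * (32 / 3 ^ K)"
      unfolding beta_R_sq using \<Delta> by (intro mult_left_mono) auto
    also have "\<dots> = (3600 * \<rho>\<^sup>2) / 3 ^ K * \<Delta>"
      by simp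
    also have "\<dots> \<le> 7 / 8 * \<Delta>"
    proof (rule mult_right_mono)
      have "3600 * \<rho>\<^sup>2 \<le> 7 / 8 * 3 ^ K"
        using large zero_le_power2[of \<rho>] by linarith
      then show "3600 * \<rho>\<^sup>2 / 3 ^ K \<le> 7 / 8"
        by (simp add: pos_divide_le_eq)
    qed (use \<Delta> in simp)
    finally show ?thesis .
  qed
  moreover have "weight K * e + c * (norm (z K - x0))\<^sup>2
      \<le> (f x0 - f (z K)) + (\<Sum>j<K. lam j * (f (z j) - f (z K)))"
  proof -
    have "f (z K) + g \<bullet> (z j - z K) \<le> f (z j)" for j
    proof -
      have "0 \<le> c * (norm (z j - z K))\<^sup>2"
        using c by simp
      then show ?thesis
        using lower[OF z_mem[of j]] by linarith
    qed
    moreover have "f (z K) + g \<bullet> (z 0 - z K) + c * (norm (z K - x0))\<^sup>2 \<le> f (z 0)"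
      using lower[OF z_mem[of 0]] by (simp add: z_0 norm_minus_commute)
    ultimately have "weight K * e + c * (norm (z K - x0))\<^sup>2
      \<le> (f (z 0) - f (z K)) + (\<Sum>j<K. lam j * (f (z j) - f (z K)))"
      unfolding weight_def e_def by (intro weighted_center_averaging lam_nonneg)
    then show ?thesis
      by (simp add: z_0)
  qed
  moreover note weighted_errors[OF K]
  moreover have "f x0 - f (z K) \<le> \<Delta> - c * (norm (z K - x0))\<^sup>2"
    using gap[OF z_mem, of K] by (simp add: regularized_def c_def)
  moreover have "0 \<le> c * (norm (z K - x0))\<^sup>2"
    using c by simp
  \<comment> \<open>The multiples of \<open>\<Delta>\<close> collected here are \<open>1 + 1/32 + 1/16 + 1/64 + 7/8 < 2\<close>.\<close>
  ultimately have "R * norm g + 2 * (c * (norm (z K - x0))\<^sup>2) \<le> 2 * \<Delta>"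
    using \<Delta> unfolding diff_divide_distrib by linarith
  then show ?thesis
    by (simp add: g_def c_def)
qed

text \<open>
  In terms of the rescaled distance \<open>s\<close>, the bound on \<open>norm (grad S h (z K)) / \<gamma>\<close> is
  \<open>2 / 5 - s\<^sup>2 / 40 + s / 8\<close>, with maximum \<open>89 / 160\<close> at \<open>s = 5 / 2\<close>.
\<close>

lemma grad_h_bound:
  assumes "0 < K" and "4200 * \<rho>\<^sup>2 \<le> 3 ^ K"
  shows "norm (grad S h (z K)) \<le> \<gamma>"
proof -
  define G where "G = norm (grad S f (z K))"
  define s where "s = \<gamma> * norm (z K - x0) / \<Delta>"
  have D: "norm (z K - x0) = s * \<Delta> / \<gamma>"
    using \<Delta> \<gamma> by (simp add: s_def)
  have "5 * \<Delta> / \<gamma> * G + \<gamma>\<^sup>2 / (8 * \<Delta>) * (s * \<Delta> / \<gamma>)\<^sup>2 \<le> 2 * \<Delta>"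
    using grad_f_bound[OF assms] unfolding R_def G_def D .
  also have "\<gamma>\<^sup>2 / (8 * \<Delta>) * (s * \<Delta> / \<gamma>)\<^sup>2 = \<Delta> * (s\<^sup>2 / 8)"
    using \<Delta> \<gamma> by (simp add: field_simps power2_eq_square)
  finally have "\<Delta> * (5 * G / \<gamma> + s\<^sup>2 / 8) \<le> \<Delta> * 2"
    by (simp add: algebra_simps)
  then have "5 * G / \<gamma> + s\<^sup>2 / 8 \<le> 2"
    using \<Delta> by (simp only: mult_le_cancel_left_pos)
  then have G: "G \<le> \<gamma> * (2 / 5 - s\<^sup>2 / 40)"
    using \<gamma> by (simp add: field_simps)
  have "grad S h (z K) = grad S f (z K) - (\<gamma>\<^sup>2 / (8 * \<Delta>)) *\<^sub>R (z K - x0)"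
    by (simp add: grad_f z_mem regularized_answer_def)
  then have "norm (grad S h (z K)) \<le> G + norm ((\<gamma>\<^sup>2 / (8 * \<Delta>)) *\<^sub>R (z K - x0))"
    unfolding G_def by (simp only: norm_triangle_ineq4)
  also have "norm ((\<gamma>\<^sup>2 / (8 * \<Delta>)) *\<^sub>R (z K - x0)) = \<gamma> * (s / 8)"
    using \<Delta> \<gamma> by (simp add: s_def power2_eq_square)
  also have "G + \<gamma> * (s / 8) \<le> \<gamma> * (2 / 5 - s\<^sup>2 / 40 + s / 8)"
    using G by (simp add: algebra_simps)
  also have "\<dots> \<le> \<gamma> * 1"
  proof (rule mult_left_mono)
    have "0 \<le> (s - 5 / 2)\<^sup>2"
      by simp
    then show "2 / 5 - s\<^sup>2 / 40 + s / 8 \<le> 1"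
      by (simp add: power2_eq_square algebra_simps)
  qed (use \<gamma> in simp)
  finally show ?thesis by simp
qed

text \<open>
  Radius and accuracy combine to \<open>\<beta> * R\<^sup>2 / (eps k * weight k)\<close>, in which the weights, of
  order \<open>2 ^ k\<close>, outgrow the inverse accuracies, of order \<open>1.5 ^ k\<close>. The ratio \<open>3 / 4\<close> is
  rounded up to the square of \<open>7 / 8\<close>.
\<close>

lemma inner_query_bound:
  "sqrt (\<beta> * (R / weight k)\<^sup>2 / (eps k / weight k)) \<le> 240 * \<rho> * (7 / 8) ^ k"
proof (rule real_le_lsqrt)
  have "\<beta> * (R / weight k)\<^sup>2 / (eps k / weight k) = \<beta> * R\<^sup>2 / eps k * (1 / weight k)"
    using weight_pos[of k] eps_pos[of k] by (simp add: field_simps power2_eq_square)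
  also have "\<dots> \<le> \<beta> * R\<^sup>2 / eps k * (32 / 2 ^ k)"
    using \<beta>_pos eps_pos[of k] inverse_weight_le by (intro mult_left_mono) auto
  also have "\<dots> = 51200 * \<rho>\<^sup>2 * (3 / 4) ^ k"
  proof -
    have "(3 / 4 :: real) ^ k = 1.5 ^ k / 2 ^ k"
      by (simp flip: power_divide)
    then show ?thesis
      unfolding beta_R_sq eps_def using \<Delta> by simp
  qed
  also have "\<dots> \<le> 57600 * \<rho>\<^sup>2 * (49 / 64) ^ k"
    using less_imp_le[OF \<rho>_pos] by (intro mult_mono power_mono) auto
  also have "\<dots> = (240 * \<rho> * (7 / 8) ^ k)\<^sup>2"
  proof -
    have "((7 / 8 :: real) ^ k)\<^sup>2 = (49 / 64) ^ k"
      by (simp add: power_mult[symmetric] mult.commute[of k]) (simp add: power_mult power2_eq_square)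
    then show ?thesis
      by (simp add: power_mult_distrib)
  qed
  finally show "\<beta> * (R / weight k)\<^sup>2 / (eps k / weight k) \<le> (240 * \<rho> * (7 / 8) ^ k)\<^sup>2" .
qed (use less_imp_le[OF \<rho>_pos] in auto)

lemma queries_bound:
  "real (length (queries (grad S h) (iterates K))) \<le> C * (real K + 1680 * \<rho>)"
proof -
  have "real (length (queries (grad S h) (iterates K)))
      \<le> C * (real K + 1680 * \<rho> * (1 - (7 / 8) ^ K))"
  \<comment> \<open>\<open>1680\<close> is \<open>240\<close> times the geometric sum \<open>\<Sum>k\<ge>1. (7 / 8) ^ k = 7\<close>.\<close>
  proof (induction K)
    case (Suc K)
    have "queries (grad S h) (iterates (Suc K)) = queries (grad S h) (iterates K) @
        queries (grad S h) (translate (regularized_answer \<gamma> \<Delta> x0) (inner_run (Suc K)))"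
      by (simp add: iterates_Suc center_of_iterates del: cp_iterates.simps)
    moreover have "real (length (queries (grad S h)
        (translate (regularized_answer \<gamma> \<Delta> x0) (inner_run (Suc K)))))
        \<le> C * (1 + 240 * \<rho> * (7 / 8) ^ Suc K)"
      using C by (intro order_trans[OF inner_run(4)[OF w_mem]] mult_left_mono add_left_mono
          inner_query_bound) auto
    ultimately have "real (length (queries (grad S h) (iterates (Suc K))))
      \<le> C * (real K + 1680 * \<rho> * (1 - (7 / 8) ^ K)) + C * (1 + 240 * \<rho> * (7 / 8) ^ Suc K)"
      using Suc by simp
    also have "\<dots> = C * (real (Suc K) + 1680 * \<rho> * (1 - (7 / 8) ^ Suc K))"
      by (simp add: algebra_simps)
    finally show ?case .
  qed simp
  also have "\<dots> \<le> C * (real K + 1680 * \<rho>)"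
  proof (intro mult_left_mono add_left_mono)
    have "1680 * \<rho> * (1 - (7 / 8) ^ K) \<le> 1680 * \<rho> * 1"
      using \<rho>_pos by (intro mult_left_mono) auto
    then show "1680 * \<rho> * (1 - (7 / 8) ^ K) \<le> 1680 * \<rho>"
      by simp
  qed (use C in auto)
  finally show ?thesis .
qed

lemma critical_point_alg_correct:
  assumes "0 < K" and "4200 * \<rho>\<^sup>2 \<le> 3 ^ K"
  shows "norm (grad S h (result (grad S h) (critical_point_alg cgm \<gamma> \<Delta> x0 lam eps K))) \<le> \<gamma>"
    and "real (length (queries (grad S h) (critical_point_alg cgm \<gamma> \<Delta> x0 lam eps K)))
      \<le> C * (real K + 1680 * \<rho>)"
  using grad_h_bound[OF assms] queries_bound
  by (auto simp: critical_point_alg_def z_def)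

end


section \<open>The number of iterations\<close>

text \<open>
  The lower bound on \<open>\<rho>\<close> keeps \<open>1 + ln \<rho>\<close> away from zero (it exceeds
  \<open>1 - ln 2 / 2 \<ge> 1 / 2\<close>), so a constant number of extra iterations can be absorbed into the
  multiplicative constant.
\<close>

lemma iteration_count:
  fixes \<rho> :: real
  assumes \<rho>: "0 < \<rho>" "1 < 2 * \<rho>\<^sup>2"
  obtains K :: nat where "0 < K" "4200 * \<rho>\<^sup>2 \<le> 3 ^ K" "real K \<le> 28 * (1 + ln \<rho>)"
proof -
  define K where "K = nat \<lceil>ln (4200 * \<rho>\<^sup>2)\<rceil>"
  have ln_pos: "0 < ln (4200 * \<rho>\<^sup>2)"
    using \<rho> by (intro ln_gt_zero) simp
  then have K: "0 < K" "ln (4200 * \<rho>\<^sup>2) \<le> real K" "real K \<le> ln (4200 * \<rho>\<^sup>2) + 1"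
    unfolding K_def by linarith+
  have "4200 * \<rho>\<^sup>2 = exp (ln (4200 * \<rho>\<^sup>2))"
    using \<rho> by simp
  also have "\<dots> \<le> exp (real K)"
    using K by simp
  also have "\<dots> = exp 1 ^ K"
    by (simp flip: exp_of_nat_mult)
  also have "\<dots> \<le> 3 ^ K"
    using exp_le by (intro power_mono) auto
  finally have large: "4200 * \<rho>\<^sup>2 \<le> 3 ^ K" .
  have "ln (4200 :: real) \<le> ln (2 ^ 13)"
    by simp
  also have "\<dots> = 13 * ln (2 :: real)"
    by (simp only: ln_realpow)
  also have "\<dots> \<le> 13"
    using ln_le_minus_one[of 2] by simp
  finally have "ln (4200 * \<rho>\<^sup>2) \<le> 13 + 2 * ln \<rho>"
    using \<rho> by (simp add: ln_mult ln_realpow)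
  moreover have "0 < ln (2 * \<rho>\<^sup>2)"
    using \<rho> by (intro ln_gt_zero) simp
  then have "0 < ln 2 + 2 * ln \<rho>"
    using \<rho> by (simp add: ln_mult ln_realpow)
  ultimately have "real K \<le> 28 * (1 + ln \<rho>)"
    using K ln_le_minus_one[of 2] by (simp add: algebra_simps)
  with K large show ?thesis
    using that by blast
qed

theorem theorem12:
  fixes C :: real
  assumes "C > 0"
  shows "\<exists>c\<^sub>K c\<^sub>Q :: real. \<forall>(n::nat) (h :: fseq \<Rightarrow> real) (\<beta>::real) (x0::fseq) (\<Delta>::real) (\<gamma>::real).
    convex_on (Rn n) h \<longrightarrow>
    smooth (Rn n) \<beta> h \<longrightarrow>
    x0 \<in> Rn n \<longrightarrow>
    bdd_below (h ` Rn n) \<longrightarrow>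
    \<Delta> = h x0 - (INF x\<in>Rn n. h x) \<longrightarrow>
    \<gamma> \<in> {0 <..< sqrt (2 * \<beta> * \<Delta>)} \<longrightarrow>
    (\<exists>K::nat.
      real K \<le> c\<^sub>K * (1 + ln (sqrt (\<beta> * \<Delta>) / \<gamma>)) \<and>
      (\<forall>cgm. cgm_oracle C \<beta> (Rn n) (regularized \<gamma> \<Delta> x0 h) cgm \<longrightarrow>
        (let p = critical_point_alg cgm \<gamma> \<Delta> x0
                   (\<lambda>k. 2 ^ k / 32) (\<lambda>k. \<Delta> / (64 * 1.5 ^ k)) K
         in norm (grad (Rn n) h (result (grad (Rn n) h) p)) \<le> \<gamma> \<and>
            real (length (queries (grad (Rn n) h) p)) \<le> c\<^sub>Q * (sqrt (\<beta> * \<Delta>) / \<gamma>))))"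
proof (rule exI[of _ 28], rule exI[of _ "1708 * C"], intro allI impI)
  fix n and h :: "fseq \<Rightarrow> real" and \<beta> \<Delta> \<gamma> :: real and x0
  assume conv: "convex_on (Rn n) h" and smooth: "smooth (Rn n) \<beta> h" and x0: "x0 \<in> Rn n"
    and bdd: "bdd_below (h ` Rn n)" and \<Delta>_def: "\<Delta> = h x0 - (INF x\<in>Rn n. h x)"
    and \<gamma>_range: "\<gamma> \<in> {0 <..< sqrt (2 * \<beta> * \<Delta>)}"
  define \<rho> where "\<rho> = sqrt (\<beta> * \<Delta>) / \<gamma>"
  have gap: "h x0 - h x \<le> \<Delta>" if "x \<in> Rn n" for x
    using cINF_lower[OF bdd that] by (simp add: \<Delta>_def)
  have \<gamma>: "0 < \<gamma>" and \<gamma>_sqrt: "\<gamma> < sqrt (2 * \<beta> * \<Delta>)"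
    using \<gamma>_range by auto
  from order.strict_trans[OF \<gamma> \<gamma>_sqrt]
  have prod: "0 < 2 * \<beta> * \<Delta>"
    by (simp only: real_sqrt_gt_0_iff)
  then have \<Delta>: "0 < \<Delta>"
    using gap[OF x0] by (cases "\<Delta> = 0") auto
  have \<gamma>_less: "\<gamma>\<^sup>2 < 2 * \<beta> * \<Delta>"
    using \<gamma> \<gamma>_sqrt prod power_strict_mono[of \<gamma> "sqrt (2 * \<beta> * \<Delta>)" 2] by simp
  have \<rho>: "0 < \<rho>" "1 < 2 * \<rho>\<^sup>2"
    using \<gamma> prod \<gamma>_less by (auto simp: \<rho>_def power_divide field_simps)
  obtain K where K: "0 < K" "4200 * \<rho>\<^sup>2 \<le> 3 ^ K" "real K \<le> 28 * (1 + ln \<rho>)"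
    using iteration_count[OF \<rho>] .
  have "real K \<le> 28 * \<rho>"
    using K(3) ln_le_minus_one[OF \<rho>(1)] by simp
  then have count: "C * (real K + 1680 * \<rho>) \<le> 1708 * C * \<rho>"
    using mult_left_mono[of "real K + 1680 * \<rho>" "1708 * \<rho>" C] assms by (simp add: mult_ac)
  have "norm (grad (Rn n) h (result (grad (Rn n) h) p)) \<le> \<gamma> \<and>
      real (length (queries (grad (Rn n) h) p)) \<le> 1708 * C * \<rho>"
    if cgm: "cgm_oracle C \<beta> (Rn n) (regularized \<gamma> \<Delta> x0 h) cgm"
      and p: "p = critical_point_alg cgm \<gamma> \<Delta> x0
        (\<lambda>k. 2 ^ k / 32) (\<lambda>k. \<Delta> / (64 * 1.5 ^ k)) K" for cgm p
  proof -
    interpret run: critical_point_run "Rn n" h \<beta> \<Delta> \<gamma> C x0 cgm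
      by unfold_locales (use subspace_Rn conv smooth x0 gap \<Delta> \<gamma> \<gamma>_less assms cgm in auto)
    have "run.lam = (\<lambda>k. 2 ^ k / 32)" "run.eps = (\<lambda>k. \<Delta> / (64 * 1.5 ^ k))" "run.\<rho> = \<rho>"
      by (auto simp: run.lam_def run.eps_def run.\<rho>_def \<rho>_def)
    then show ?thesis
      using run.critical_point_alg_correct[of K] K count p by auto
  qed
  with K(3) show "\<exists>K::nat.
      real K \<le> 28 * (1 + ln (sqrt (\<beta> * \<Delta>) / \<gamma>)) \<and>
      (\<forall>cgm. cgm_oracle C \<beta> (Rn n) (regularized \<gamma> \<Delta> x0 h) cgm \<longrightarrow>
        (let p = critical_point_alg cgm \<gamma> \<Delta> x0
                   (\<lambda>k. 2 ^ k / 32) (\<lambda>k. \<Delta> / (64 * 1.5 ^ k)) K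
         in norm (grad (Rn n) h (result (grad (Rn n) h) p)) \<le> \<gamma> \<and>
            real (length (queries (grad (Rn n) h) p)) \<le> 1708 * C * (sqrt (\<beta> * \<Delta>) / \<gamma>)))"
    unfolding Let_def \<rho>_def[symmetric] by blast
qed

end
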